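(* Let $d\ge 2$ and let $\rho$ be a density operator on $\mathbb{C}^d\otimes\mathbb{C}^d$ of rank $n$ belonging to the class $\mathcal{D}$. Let $\rho=\sum_{k=1}^n|\phi_k\rangle\langle\phi_k|$ be a decomposition into sub-normalized vectors whose $\tau$-tensor is diagonal with non-negative diagonal entries, i.e. $\tau^{\phi}_{k_1k_2\dots k_d}=\lambda_{k_1}\delta_{k_1k_2}\cdots\delta_{k_1k_d}$ with real $\lambda_k\ge 0$, ordered so that $\lambda_1\ge\lambda_k$ for all $k=1,\dots,n$. If $\lambda_1>\lambda_2+\dots+\lambda_n$, then $$\lambda_1^{2/d}-\sum_{k=2}^n\lambda_k^{2/d}\ \le\ G(\rho)\ \le\ \left|\lambda_1-\sum_{k=2}^n\lambda_k\right|^{2/d}.$$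
   Context: G-concurrence: for a (possibly sub-normalized) vector $|\phi\rangle=\sum_{i,j=1}^d a_{ij}|i\rangle|j\rangle\in\mathbb{C}^d\otimes\mathbb{C}^d$ with $A=(a_{ij})$, $G(|\phi\rangle)=d\,[\mathrm{Det}(A^\dagger A)]^{1/d}$ (so $G(\sqrt p\,|\phi\rangle)=p\,G(|\phi\rangle)$). A decomposition of a density operator $\rho$ is a finite family of sub-normalized vectors $|\chi_l\rangle$, $l=1,\dots,m$, with $\rho=\sum_{l=1}^m|\chi_l\rangle\langle\chi_l|$. For a density operator $\rho$ on $\mathbb{C}^d\otimes\mathbb{C}^d$, $G(\rho)=\min\sum_l G(|\chi_l\rangle)$ over all finite decompositions of $\rho$. $\tau$-tensor: fix the product basis $|i\rangle|j\rangle$. For a decomposition $\rho=\sum_{k}|\phi_k\rangle\langle\phi_k|$ write $|\phi_k\rangle=\sum_{i,j=1}^d \overline{a_{ij}^{k}}\,|i\rangle|j\rangle$, and set $$\tau^\phi_{k_1\dots k_d}=\frac{d^{d/2}}{d!}\sum_{\sigma\in S_d}\mathrm{Det}\left(a^{k_{\sigma(i)}}_{ij}\right)_{i,j=1}^d ,$$ i.e. row $i$ of the matrix is $(a_{i1}^{k_{\sigma(i)}},\dots,a_{id}^{k_{\sigma(i)}})$. Class $\mathcal{D}$: let $\rho$ have rank $n$ and let $\rho=\sum_{k=1}^n|\phi_k\rangle\langle\phi_k|$ be its eigen-decomposition into orthogonal sub-normalized eigenvectors. Every decomposition with $m\ge n$ elements has the form $|\chi_l\rangle=\sum_{k=1}^n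 \overline{U_{lk}}|\phi_k\rangle$ with $U$ an $m\times m$ unitary. Then $\rho\in\mathcal{D}$ if there is a unitary $U$ for which $\tau^\chi$ is a diagonal tensor (all entries vanish unless all indices are equal). For $\rho\in\mathcal{D}$ it is the paper's convention to replace the $\phi_k$ ($k=1,\dots,n$) by a decomposition for which the $\tau$-tensor is diagonal and, after absorbing phases, has non-negative diagonal entries $\lambda_k$. *)

theory Defs
  imports "HOL-Analysis.Analysis"
begin

text \<open>
  The space \<open>\<complex>\<^sup>d \<otimes> \<complex>\<^sup>d\<close> is \<^typ>\<open>complex^('d \<times> 'd)\<close>: the index type \<open>'d\<close> (with \<open>d = CARD('d)\<close>)
  labels the fixed basis of \<open>\<complex>\<^sup>d\<close>, and the \<open>(i, j)\<close>-component of a vector is its coefficient at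
  the product basis vector \<open>|i\<rangle>|j\<rangle>\<close>. Operators are matrices with respect to the product basis.
  Families of vectors are functions on \<^typ>\<open>nat\<close>; only the values on \<open>{1..m}\<close> matter.
\<close>

definition conj_transpose :: "complex^'n^'m \<Rightarrow> complex^'m^'n" where
  "conj_transpose A = (\<chi> i j. cnj (A $ j $ i))"

definition cinner :: "complex^'n \<Rightarrow> complex^'n \<Rightarrow> complex" where
  "cinner v w = (\<Sum>i\<in>UNIV. cnj (v $ i) * w $ i)"

text \<open>The operator \<open>|v\<rangle>\<langle>v|\<close>.\<close>

definition ket_bra :: "complex^'n \<Rightarrow> complex^'n^'n" where
  "ket_bra v = (\<chi> i j. v $ i * cnj (v $ j))"

definition density_operator :: "complex^'n^'n \<Rightarrow> bool" where
  "density_operator \<rho> \<longleftrightarrow>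
     conj_transpose \<rho> = \<rho> \<and> (\<forall>v. 0 \<le> Re (cinner v (\<rho> *v v))) \<and> trace \<rho> = 1"

definition decomposition :: "complex^'n^'n \<Rightarrow> nat \<Rightarrow> (nat \<Rightarrow> complex^'n) \<Rightarrow> bool" where
  "decomposition \<rho> m \<psi> \<longleftrightarrow>
     (\<forall>l\<in>{1..m}. norm (\<psi> l) \<le> 1) \<and> \<rho> = (\<Sum>l=1..m. ket_bra (\<psi> l))"

definition eigen_decomposition :: "complex^'n^'n \<Rightarrow> nat \<Rightarrow> (nat \<Rightarrow> complex^'n) \<Rightarrow> bool" where
  "eigen_decomposition \<rho> n \<phi> \<longleftrightarrow>
     decomposition \<rho> n \<phi> \<and>
     (\<forall>k\<in>{1..n}. \<phi> k \<noteq> 0 \<and> (\<exists>c. \<rho> *v \<phi> k = c *s \<phi> k)) \<and>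
     (\<forall>k\<in>{1..n}. \<forall>l\<in>{1..n}. k \<noteq> l \<longrightarrow> cinner (\<phi> k) (\<phi> l) = 0)"

definition coeff_matrix :: "complex^('d::finite \<times> 'd) \<Rightarrow> complex^'d^'d" where
  "coeff_matrix v = (\<chi> i j. v $ (i, j))"

text \<open>
  The determinant of \<open>A\<^sup>\<dagger> A\<close> is the non-negative real number \<open>|det A|\<^sup>2\<close>
  (\<open>det_conj_transpose_mult\<close> below), so taking its real part loses nothing.
\<close>

definition G_conc :: "complex^('d::finite \<times> 'd) \<Rightarrow> real" where
  "G_conc v = real CARD('d) *
     Re (det (conj_transpose (coeff_matrix v) ** coeff_matrix v)) powr (1 / real CARD('d))"

definition G_values :: "complex^('d::finite \<times> 'd)^('d \<times> 'd) \<Rightarrow> real set" where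
  "G_values \<rho> = {\<Sum>l=1..m. G_conc (\<psi> l) |m \<psi>. decomposition \<rho> m \<psi>}"

text \<open>
  On the reals, \<open>LEAST\<close> denotes the minimum of a set only if the minimum is attained;
  for density operators this is \<open>G_mixed_minimum\<close> below.
\<close>

definition G_mixed :: "complex^('d::finite \<times> 'd)^('d \<times> 'd) \<Rightarrow> real" where
  "G_mixed \<rho> = (LEAST g. g \<in> G_values \<rho>)"

text \<open>
  The tensor is built from the complex conjugates \<open>a\<^sup>k\<^sub>i\<^sub>j\<close> of the coefficients of \<open>\<phi>\<^sub>k\<close>, whence the \<open>cnj\<close>.
  A multi-index \<open>(k\<^sub>1, \<dots>, k\<^sub>d)\<close> is a function \<open>k :: 'd \<Rightarrow> nat\<close>.
\<close>

definition tau :: "(nat \<Rightarrow> complex^('d::finite \<times> 'd)) \<Rightarrow> ('d \<Rightarrow> nat) \<Rightarrow> complex" where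
  "tau \<phi> k =
     of_real (real CARD('d) powr (real CARD('d) / 2) / fact CARD('d)) *
     (\<Sum>\<sigma>\<in>{\<sigma>. \<sigma> permutes (UNIV :: 'd set)}.
        det ((\<chi> i j. cnj (\<phi> (k (\<sigma> i)) $ (i, j))) :: complex^'d^'d))"

definition diagonal_tensor :: "nat \<Rightarrow> (('d \<Rightarrow> nat) \<Rightarrow> complex) \<Rightarrow> bool" where
  "diagonal_tensor m T \<longleftrightarrow>
     (\<forall>k. (\<forall>i. k i \<in> {1..m}) \<longrightarrow> (\<exists>i j. k i \<noteq> k j) \<longrightarrow> T k = 0)"

definition unitary :: "nat \<Rightarrow> (nat \<Rightarrow> nat \<Rightarrow> complex) \<Rightarrow> bool" where
  "unitary m U \<longleftrightarrow>
     (\<forall>k\<in>{1..m}. \<forall>k'\<in>{1..m}. (\<Sum>l=1..m. cnj (U l k) * U l k') = (if k = k' then 1 else 0)) \<and>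
     (\<forall>l\<in>{1..m}. \<forall>l'\<in>{1..m}. (\<Sum>k=1..m. U l k * cnj (U l' k)) = (if l = l' then 1 else 0))"

definition class_D :: "(complex^('d::finite \<times> 'd)^('d \<times> 'd)) set" where
  "class_D = {\<rho>. density_operator \<rho> \<and>
     (\<exists>\<phi> m U. eigen_decomposition \<rho> (rank \<rho>) \<phi> \<and> rank \<rho> \<le> m \<and> unitary m U \<and>
        diagonal_tensor m (tau (\<lambda>l. \<Sum>k=1..rank \<rho>. cnj (U l k) *s \<phi> k)))}"


subsection \<open>Attainment of the minimum\<close>

lemma det_conj: "det ((\<chi> i j. cnj (A $ i $ j)) :: complex^'n^'n) = cnj (det A)"
  by (simp add: det_def)

lemma det_conj_transpose_mult:
  fixes A :: "complex^'n^'n"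
  shows "det (conj_transpose A ** A) = of_real ((cmod (det A))\<^sup>2)"
proof -
  have "conj_transpose A = transpose (\<chi> i j. cnj (A $ i $ j))"
    by (simp add: conj_transpose_def transpose_def)
  then have "det (conj_transpose A) = cnj (det A)"
    by (simp add: det_transpose det_conj)
  then show ?thesis
    by (simp add: det_mul complex_norm_square mult.commute del: of_real_power)
qed

lemma G_conc_altdef:
  fixes v :: "complex^('d::finite \<times> 'd)"
  shows "G_conc v = real CARD('d) * ((cmod (det (coeff_matrix v)))\<^sup>2) powr (1 / real CARD('d))"
  unfolding G_conc_def det_conj_transpose_mult by simp

lemma G_conc_scaleR:
  fixes v :: "complex^('d::finite \<times> 'd)"
  assumes "0 \<le> r"
  shows "G_conc (r *\<^sub>R v) = r\<^sup>2 * G_conc v"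
proof -
  have "coeff_matrix (r *\<^sub>R v) = (\<chi> i. complex_of_real r *s (coeff_matrix v $ i))"
    by (simp add: coeff_matrix_def vec_eq_iff scaleR_conv_of_real[where 'a = complex])
  then have "det (coeff_matrix (r *\<^sub>R v)) = of_real r ^ CARD('d) * det (coeff_matrix v)"
    using det_rows_mul[of "\<lambda>_. complex_of_real r" "\<lambda>i. coeff_matrix v $ i"]
    by (simp add: vec_lambda_eta)
  then have "(cmod (det (coeff_matrix (r *\<^sub>R v))))\<^sup>2 =
      (r\<^sup>2) ^ CARD('d) * (cmod (det (coeff_matrix v)))\<^sup>2"
    using assms by (simp add: norm_mult norm_power power_mult_distrib mult.commute flip: power_mult)
  moreover have "((r\<^sup>2) ^ CARD('d)) powr (1 / real CARD('d)) = r\<^sup>2"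
  proof (cases "r = 0")
    case False
    then have "(r\<^sup>2) ^ CARD('d) = (r\<^sup>2) powr real CARD('d)"
      by (intro powr_realpow[symmetric]) simp
    then show ?thesis
      using False by (simp only: powr_powr) simp
  qed (simp add: zero_power)
  ultimately show ?thesis
    by (simp add: G_conc_altdef powr_mult)
qed

lemma ket_bra_scaleR: "ket_bra (r *\<^sub>R v) = r\<^sup>2 *\<^sub>R ket_bra v"
  by (simp add: ket_bra_def vec_eq_iff power2_eq_square)

lemma continuous_on_G_conc: "continuous_on S G_conc"
proof -
  have "continuous_on S (\<lambda>v. (cmod (det (coeff_matrix v)))\<^sup>2)"
    unfolding det_def coeff_matrix_def vec_lambda_beta
    by (intro continuous_intros)
  then show ?thesis
    unfolding G_conc_altdef
    by (intro continuous_on_mult continuous_on_const continuous_on_powr') auto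
qed

lemma continuous_on_ket_bra: "continuous_on S ket_bra"
proof -
  have cnj': "continuous_on S (\<lambda>v. cnj (v $ j))" for S :: "(complex^'n) set" and j
    by (intro continuous_intros)
  show ?thesis
    unfolding ket_bra_def by (intro continuous_intros cnj')
qed

lemma trace_ket_bra: "trace (ket_bra v) = of_real ((norm v)\<^sup>2)"
proof -
  have "(norm v)\<^sup>2 = (\<Sum>i\<in>UNIV. (norm (v $ i))\<^sup>2)"
    by (simp add: norm_vec_def L2_set_def sum_nonneg)
  then show ?thesis
    by (simp add: trace_def ket_bra_def complex_norm_square del: of_real_power)
qed

lemma trace_sum: "trace (\<Sum>l\<in>L. f l) = (\<Sum>l\<in>L. trace (f l))"
  unfolding trace_def sum_component by (rule sum.swap)

text \<open>
  The values of \<open>G\<close> on the decompositions of \<open>\<rho>\<close> form a slice of the convex hull of the compact set of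
  pairs \<open>(|v\<rangle>\<langle>v|, G(v))\<close> with \<open>v\<close> a unit vector.
\<close>

lemma G_values_eq:
  fixes \<rho> :: "complex^('d::finite \<times> 'd)^('d \<times> 'd)"
  assumes "trace \<rho> = 1"
  shows "g \<in> G_values \<rho> \<longleftrightarrow>
    (\<rho>, g) \<in> convex hull ((\<lambda>v. (ket_bra v, G_conc v)) ` sphere 0 1)"
    (is "_ \<longleftrightarrow> _ \<in> convex hull (?F ` _)")
proof
  assume "g \<in> G_values \<rho>"
  then obtain m \<psi> where \<psi>: "decomposition \<rho> m \<psi>" and g: "g = (\<Sum>l=1..m. G_conc (\<psi> l))"
    by (auto simp: G_values_def)
  from \<psi> have \<rho>: "\<rho> = (\<Sum>l=1..m. ket_bra (\<psi> l))"
    by (simp add: decomposition_def)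
  obtain e :: "complex^('d \<times> 'd)" where e: "norm e = 1"
    using vector_choose_size[of 1] by auto
  define v where "v l = (if \<psi> l = 0 then e else (1 / norm (\<psi> l)) *\<^sub>R \<psi> l)" for l
  have v: "norm (v l) = 1" "\<psi> l = norm (\<psi> l) *\<^sub>R v l" for l
    by (auto simp: v_def e)
  have "complex_of_real (\<Sum>l=1..m. (norm (\<psi> l))\<^sup>2) = trace \<rho>"
    unfolding \<rho> trace_sum trace_ket_bra by simp
  then have "(\<Sum>l=1..m. (norm (\<psi> l))\<^sup>2) = 1"
    using assms of_real_eq_1_iff by metis
  moreover have "(\<Sum>l=1..m. (norm (\<psi> l))\<^sup>2 *\<^sub>R ?F (v l)) = (\<rho>, g)"
  proof -
    have "(norm (\<psi> l))\<^sup>2 *\<^sub>R ?F (v l) = ?F (\<psi> l)" for l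
      using ket_bra_scaleR[of "norm (\<psi> l)" "v l"] G_conc_scaleR[of "norm (\<psi> l)" "v l"]
      by (simp flip: v(2))
    then show ?thesis
      by (simp add: \<rho> g sum_prod)
  qed
  moreover have "\<forall>l\<in>{1..m}. 0 \<le> (norm (\<psi> l))\<^sup>2 \<and> ?F (v l) \<in> ?F ` sphere 0 1"
    using v(1) by simp
  ultimately show "(\<rho>, g) \<in> convex hull (?F ` sphere 0 1)"
    unfolding convex_hull_indexed mem_Collect_eq
    by (intro exI[of _ m] exI[of _ "\<lambda>l. (norm (\<psi> l))\<^sup>2"] exI[of _ "\<lambda>l. ?F (v l)"] conjI)
next
  assume "(\<rho>, g) \<in> convex hull (?F ` sphere 0 1)"
  then obtain m u x where x: "\<forall>i\<in>{1::nat..m}. 0 \<le> u i \<and> x i \<in> ?F ` sphere 0 1"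
    and u: "sum u {1..m} = 1" and s: "(\<Sum>i=1..m. u i *\<^sub>R x i) = (\<rho>, g)"
    unfolding convex_hull_indexed by blast
  have "\<exists>v. norm v = 1 \<and> x i = ?F v" if "i \<in> {1..m}" for i
  proof -
    from x that obtain v where "v \<in> sphere 0 1" "x i = ?F v"
      by blast
    then show ?thesis by auto
  qed
  then obtain v where v: "\<And>i. i \<in> {1..m} \<Longrightarrow> norm (v i) = 1" "\<And>i. i \<in> {1..m} \<Longrightarrow> x i = ?F (v i)"
    by metis
  define \<psi> where "\<psi> i = sqrt (u i) *\<^sub>R v i" for i
  have "?F (\<psi> i) = u i *\<^sub>R x i" if "i \<in> {1..m}" for i
    using x that by (simp add: \<psi>_def ket_bra_scaleR G_conc_scaleR v(2))
  then have "(\<Sum>i=1..m. ?F (\<psi> i)) = (\<rho>, g)"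
    using s by simp
  then have "(\<Sum>i=1..m. ket_bra (\<psi> i)) = \<rho>" "(\<Sum>i=1..m. G_conc (\<psi> i)) = g"
    by (simp_all add: sum_prod)
  moreover have "norm (\<psi> i) \<le> 1" if "i \<in> {1..m}" for i
  proof -
    have "u i \<le> 1"
      using member_le_sum[of i "{1..m}" u] x u that by auto
    then show ?thesis
      using x that v(1) by (simp add: \<psi>_def)
  qed
  ultimately have "decomposition \<rho> m \<psi>"
    by (simp add: decomposition_def)
  with \<open>(\<Sum>i=1..m. G_conc (\<psi> i)) = g\<close> show "g \<in> G_values \<rho>"
    by (auto simp: G_values_def)
qed

lemma G_mixed_minimum:
  fixes \<rho> :: "complex^('d::finite \<times> 'd)^('d \<times> 'd)"
  assumes "trace \<rho> = 1" and "decomposition \<rho> m \<psi>"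
  shows "G_mixed \<rho> \<in> G_values \<rho>" and "\<And>g. g \<in> G_values \<rho> \<Longrightarrow> G_mixed \<rho> \<le> g"
proof -
  let ?K = "convex hull ((\<lambda>v. (ket_bra v, G_conc v)) ` sphere 0 1)
    :: ((complex^('d \<times> 'd)^('d \<times> 'd)) \<times> real) set"
  have "compact ?K"
    by (intro compact_convex_hull compact_continuous_image continuous_on_Pair
        continuous_on_ket_bra continuous_on_G_conc compact_sphere)
  then have "compact (?K \<inter> {\<rho>} \<times> UNIV)"
    by (intro compact_Int_closed closed_Times) auto
  then have "compact (snd ` (?K \<inter> {\<rho>} \<times> UNIV))"
    by (intro compact_continuous_image continuous_intros)
  moreover have "snd ` (?K \<inter> {\<rho>} \<times> UNIV) = G_values \<rho>"
    using G_values_eq[OF assms(1)] by force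
  ultimately have "compact (G_values \<rho>)"
    by simp
  moreover have "G_values \<rho> \<noteq> {}"
    using assms(2) by (auto simp: G_values_def)
  ultimately obtain g0 where g0: "g0 \<in> G_values \<rho>" "\<And>g. g \<in> G_values \<rho> \<Longrightarrow> g0 \<le> g"
    using compact_attains_inf by metis
  then have "G_mixed \<rho> = g0"
    unfolding G_mixed_def by (intro Least_equality)
  with g0 show "G_mixed \<rho> \<in> G_values \<rho>" "\<And>g. g \<in> G_values \<rho> \<Longrightarrow> G_mixed \<rho> \<le> g"
    by auto
qed

end

theory Submission
  imports Defs
begin

text \<open>
  Multilinearity of the determinant and diagonality of \<open>\<tau>\<close> give
  \<open>G(\<Sum>\<^sub>k c\<^sub>k |\<phi>\<^sub>k\<rangle>) = |\<Sum>\<^sub>k \<lambda>\<^sub>k c\<^sub>k\<^sup>d|\<^sup>2\<^sup>/\<^sup>d\<close> (up to conjugating the \<open>c\<^sub>k\<close>). As \<open>n\<close> is the rank of \<open>\<rho>\<close>, the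
  decompositions of \<open>\<rho>\<close> are exactly the families with coefficient matrices having orthonormal columns.
  The lower bound is then the triangle inequality together with the subadditivity of \<open>x\<^sup>2\<^sup>/\<^sup>d\<close>. For the
  upper bound take coefficients of equal modulus, with \<open>d\<close>-th powers of the first column positive and those
  of the others negative: column \<open>k\<close> is, up to a phase, the character \<open>f \<mapsto> \<omega>\<^bsup>f(k)\<^esup>\<close> of \<open>(\<int>/d)\<^sup>n\<close>, and
  distinct characters are orthogonal.
\<close>

section \<open>Subadditivity of powers with exponent in [0, 1]\<close>

text \<open>The shares \<open>x / (x + y)\<close> and \<open>y / (x + y)\<close> lie in [0, 1] and
  add up to 1, and raising a number of [0, 1] to the power \<open>p\<close> does not decrease it.
  Multiplying by \<open>(x + y) powr p\<close> gives the claim.\<close>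

lemma powr_add_le:
  fixes x y p :: real
  assumes "0 \<le> x" "0 \<le> y" "0 \<le> p" "p \<le> 1"
  shows "(x + y) powr p \<le> x powr p + y powr p"
proof (cases "x + y = 0")
  case False
  then have pos: "0 < x + y"
    using assms by linarith
  have le: "t \<le> t powr p" if "0 \<le> t" "t \<le> 1" for t :: real
    using powr_mono'[of p 1 t] that assms by (cases "t = 0") auto
  have "x / (x + y) + y / (x + y) = 1"
    using pos by (simp flip: add_divide_distrib)
  then have "1 \<le> (x / (x + y)) powr p + (y / (x + y)) powr p"
    using le[of "x / (x + y)"] le[of "y / (x + y)"] pos assms by simp
  also have "\<dots> = (x powr p + y powr p) / (x + y) powr p"
    using pos assms by (simp add: powr_divide add_divide_distrib)
  finally show ?thesis
    using pos by (simp add: le_divide_eq)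
qed (use assms in simp)

lemma powr_sum_le:
  fixes x :: "'a \<Rightarrow> real"
  assumes "finite A" "\<And>k. k \<in> A \<Longrightarrow> 0 \<le> x k" "0 \<le> p" "p \<le> 1"
  shows "(\<Sum>k\<in>A. x k) powr p \<le> (\<Sum>k\<in>A. x k powr p)"
  using assms(1,2)
proof (induction rule: finite_induct)
  case (insert a A)
  then have "(x a + sum x A) powr p \<le> x a powr p + sum x A powr p"
    using assms(3,4) by (intro powr_add_le sum_nonneg) auto
  also have "\<dots> \<le> x a powr p + (\<Sum>k\<in>A. x k powr p)"
    using insert by simp
  finally show ?case
    using insert by simp
qed simp

text \<open>With exponent \<open>2 / d\<close>, terms homogeneous of degree \<open>d\<close> in the
  coefficients become squared moduli, which can be summed along a column of norm one.\<close>

lemma powr_mult_power: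
  fixes l x :: real
  assumes "0 \<le> l" "0 \<le> x" "0 < d"
  shows "(l * x ^ d) powr (2 / real d) = l powr (2 / real d) * x\<^sup>2"
proof (cases "x = 0")
  case False
  then have x: "0 < x"
    using assms by simp
  have "(x ^ d) powr (2 / real d) = (x powr real d) powr (2 / real d)"
    by (simp only: powr_realpow[OF x])
  also have "\<dots> = x\<^sup>2"
    using x assms by (simp add: powr_powr)
  finally show ?thesis
    using assms False by (simp add: powr_mult)
qed (use assms in \<open>simp add: zero_power\<close>)

section \<open>Multilinear expansion of the determinant, and the tensor \<open>tau\<close>\<close>

lemma prod_comp_permutes:
  assumes "\<sigma> permutes (UNIV :: 'd::finite set)"
  shows "(\<Prod>i\<in>UNIV. g (f (\<sigma> i))) = (\<Prod>i\<in>UNIV. g (f i))"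
  using prod.permute[OF assms, of "\<lambda>i. g (f i)"] by (simp add: o_def)

lemma det_sum_rows:
  fixes a :: "'n::finite \<Rightarrow> 'k \<Rightarrow> 'a::comm_ring_1^'n"
  assumes "finite K"
  shows "det (\<chi> i. \<Sum>k\<in>K. a i k) = (\<Sum>f | \<forall>i. f i \<in> K. det (\<chi> i. a i (f i)))"
proof -
  \<comment> \<open>Over the domain \<open>UNIV\<close> extensionality is no restriction, so choice
    functions are plain functions and a product of sums expands over them.\<close>
  have *: "{f. \<forall>i. f i \<in> K} = Pi\<^sub>E (UNIV :: 'n set) (\<lambda>_. K)"
    by (auto simp: PiE_def)
  show ?thesis
    unfolding det_def * using assms
    by (simp add: prod_sum_PiE sum_distrib_left) (rule sum.swap)
qed

text \<open>Expanding every row gives a sum over multi-indices \<open>f\<close>. The weight of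
  \<open>f\<close> does not change under \<open>f \<mapsto> f \<circ> \<sigma>\<close>, so each
  determinant may be replaced by its average over all permutations, which is \<open>tau\<close> up
  to its prefactor. The conjugates match those in \<open>tau\<close>.\<close>

lemma cnj_det_coeff_matrix_sum:
  fixes \<phi> :: "nat \<Rightarrow> complex^('d::finite \<times> 'd)"
  assumes "finite K"
  shows "of_real (real CARD('d) powr (real CARD('d) / 2)) * cnj (det (coeff_matrix (\<Sum>k\<in>K. c k *s \<phi> k))) =
    (\<Sum>f | \<forall>i. f i \<in> K. (\<Prod>i\<in>UNIV. cnj (c (f i))) * tau \<phi> f)"
proof -
  define F where "F = {f :: 'd \<Rightarrow> nat. \<forall>i. f i \<in> K}"
  define P where "P = {\<sigma>. \<sigma> permutes (UNIV :: 'd set)}"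
  define p where "p f = (\<Prod>i\<in>UNIV. cnj (c (f i)))" for f :: "'d \<Rightarrow> nat"
  define D where "D f = det ((\<chi> i j. cnj (\<phi> (f i) $ (i, j))) :: complex^'d^'d)" for f
  let ?q = "complex_of_real (real CARD('d) powr (real CARD('d) / 2))"
  have cardP: "card P = fact CARD('d)"
    unfolding P_def by (rule card_permutations) auto
  have tau: "tau \<phi> f = ?q / fact CARD('d) * (\<Sum>\<sigma>\<in>P. D (f \<circ> \<sigma>))" for f
    by (simp add: tau_def D_def P_def)
  have "cnj (det (coeff_matrix (\<Sum>k\<in>K. c k *s \<phi> k))) =
    det (\<chi> i. \<Sum>k\<in>K. cnj (c k) *s (\<chi> j. cnj (\<phi> k $ (i, j))))"
    unfolding det_conj[symmetric]
    by (rule arg_cong[where f = det]) (simp add: vec_eq_iff coeff_matrix_def)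
  also have "\<dots> = (\<Sum>f\<in>F. p f * D f)"
    unfolding det_sum_rows[OF assms] det_rows_mul F_def p_def D_def ..
  finally have det: "cnj (det (coeff_matrix (\<Sum>k\<in>K. c k *s \<phi> k))) = (\<Sum>f\<in>F. p f * D f)" .
  have shift: "(\<Sum>f\<in>F. p f * D f) = (\<Sum>f\<in>F. p f * D (f \<circ> \<sigma>))" if "\<sigma> \<in> P" for \<sigma>
  proof -
    have \<sigma>: "\<sigma> permutes UNIV" "bij \<sigma>"
      using that permutes_bij by (auto simp: P_def)
    have "bij_betw (\<lambda>f. f \<circ> \<sigma>) F F"
    proof (rule bij_betwI[where g = "\<lambda>f. f \<circ> inv \<sigma>"])
      show "f \<circ> \<sigma> \<circ> inv \<sigma> = f" "f \<circ> inv \<sigma> \<circ> \<sigma> = f" for f :: "'d \<Rightarrow> nat"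
        using \<sigma> by (auto simp: fun_eq_iff permutes_inverses)
    qed (auto simp: F_def)
    then have "(\<Sum>f\<in>F. p f * D f) = (\<Sum>f\<in>F. p (f \<circ> \<sigma>) * D (f \<circ> \<sigma>))"
      by (rule sum.reindex_bij_betw[symmetric])
    moreover have "p (f \<circ> \<sigma>) = p f" for f
      using prod_comp_permutes[OF \<sigma>(1), of "\<lambda>k. cnj (c k)" f] by (simp add: p_def)
    ultimately show ?thesis
      by simp
  qed
  \<comment> \<open>The sum is written once for every permutation and each copy is shifted by its
    own \<open>\<sigma>\<close>; this produces the symmetrization.\<close>
  have "fact CARD('d) * (\<Sum>f\<in>F. p f * D f) = (\<Sum>\<sigma>\<in>P. \<Sum>f\<in>F. p f * D f)"
    using cardP by simp
  also have "\<dots> = (\<Sum>\<sigma>\<in>P. \<Sum>f\<in>F. p f * D (f \<circ> \<sigma>))"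
    by (rule sum.cong[OF refl shift])
  also have "\<dots> = (\<Sum>f\<in>F. p f * (\<Sum>\<sigma>\<in>P. D (f \<circ> \<sigma>)))"
    unfolding sum_distrib_left by (rule sum.swap)
  finally have "(\<Sum>f\<in>F. p f * D f) = (\<Sum>f\<in>F. p f * (\<Sum>\<sigma>\<in>P. D (f \<circ> \<sigma>))) / fact CARD('d)"
    by (simp add: field_simps)
  also have "?q * \<dots> = (\<Sum>f\<in>F. p f * (?q / fact CARD('d) * (\<Sum>\<sigma>\<in>P. D (f \<circ> \<sigma>))))"
    unfolding sum_divide_distrib sum_distrib_left[of ?q] by (simp add: mult_ac)
  finally show ?thesis
    unfolding det tau F_def p_def .
qed

text \<open>In the multilinear expansion only constant multi-indices survive, and the weight of the
  constant \<open>k\<close> is the conjugate of \<open>c k ^ d\<close>.\<close>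

lemma G_conc_diagonal_tensor:
  fixes \<phi> :: "nat \<Rightarrow> complex^('d::finite \<times> 'd)"
  assumes diag: "diagonal_tensor n (tau \<phi>)"
    and lam: "\<And>k. k \<in> {1..n} \<Longrightarrow> tau \<phi> (\<lambda>_. k) = of_real (lam k)"
  shows "G_conc (\<Sum>k=1..n. c k *s \<phi> k) =
    cmod (\<Sum>k=1..n. of_real (lam k) * c k ^ CARD('d)) powr (2 / real CARD('d))"
proof -
  let ?d = "real CARD('d)"
  define F where "F = {f :: 'd \<Rightarrow> nat. \<forall>i. f i \<in> {1..n}}"
  define S where "S = (\<Sum>k=1..n. of_real (lam k) * c k ^ CARD('d))"
  define x where "x = cmod (det (coeff_matrix (\<Sum>k=1..n. c k *s \<phi> k)))"
  let ?h = "\<lambda>f. (\<Prod>i\<in>UNIV. cnj (c (f i))) * tau \<phi> f"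
  have "finite F"
  proof -
    have "F = Pi\<^sub>E UNIV (\<lambda>_. {1..n})"
      by (auto simp: F_def PiE_def)
    then show ?thesis
      by (simp add: finite_PiE)
  qed
  have "sum ?h F = sum ?h ((\<lambda>k _. k) ` {1..n})"
  proof (rule sum.mono_neutral_right[OF \<open>finite F\<close>])
    show "\<forall>f\<in>F - (\<lambda>k _. k) ` {1..n}. ?h f = 0"
    proof
      fix f assume f: "f \<in> F - (\<lambda>k _. k) ` {1..n}"
      have "\<exists>i j. f i \<noteq> f j"
      proof (rule ccontr)
        assume "\<nexists>i j. f i \<noteq> f j"
        then have "f = (\<lambda>_. f undefined)"
          by (auto simp: fun_eq_iff)
        then show False
          using f by (auto simp: F_def)
      qed
      then show "?h f = 0"
        using diag f by (simp add: diagonal_tensor_def F_def)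
    qed
  qed (auto simp: F_def)
  also have "\<dots> = (\<Sum>k=1..n. ?h (\<lambda>_. k))"
    by (rule sum.reindex_cong[where l = "\<lambda>k _. k"]) (auto simp: inj_on_def fun_eq_iff)
  also have "\<dots> = cnj S"
    by (simp add: S_def lam mult.commute)
  finally have "of_real (?d powr (?d / 2)) * cnj (det (coeff_matrix (\<Sum>k=1..n. c k *s \<phi> k))) = cnj S"
    using cnj_det_coeff_matrix_sum[of "{1..n}" c \<phi>] by (simp add: F_def)
  then have "cmod (of_real (?d powr (?d / 2)) * cnj (det (coeff_matrix (\<Sum>k=1..n. c k *s \<phi> k)))) = cmod (cnj S)"
    by simp
  then have S: "cmod S = ?d powr (?d / 2) * x"
    by (simp add: norm_mult x_def)
  have sq: "(y\<^sup>2) powr (1 / ?d) = y powr (2 / ?d)" if "0 \<le> y" for y :: real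
  proof (cases "y = 0")
    case False
    then have "y\<^sup>2 = y powr 2"
      using that by simp
    then show ?thesis
      by (simp only: powr_powr) simp
  qed simp
  \<comment> \<open>The prefactor \<open>d powr (d / 2)\<close> of \<open>tau\<close>, raised to
    \<open>2 / d\<close>, is exactly the factor \<open>d\<close> in \<open>G_conc\<close>.\<close>
  have "cmod S powr (2 / ?d) = ?d * x powr (2 / ?d)"
    by (simp add: S powr_mult powr_powr x_def)
  then show ?thesis
    by (simp add: G_conc_altdef sq S_def x_def)
qed

section \<open>Quadratic forms and the span of a decomposition\<close>

lemma cinner_add_right: "cinner v (w + z) = cinner v w + cinner v z"
  by (simp add: cinner_def ring_distribs sum.distrib)

lemma cinner_zero_right: "cinner v 0 = 0"
  by (simp add: cinner_def)

lemma cinner_ket_bra: "cinner w (ket_bra v *v w) = of_real ((cmod (cinner v w))\<^sup>2)"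
proof -
  have "ket_bra v *v w = cinner v w *s v"
    by (simp add: vec_eq_iff ket_bra_def matrix_vector_mult_def cinner_def sum_distrib_left
        sum_distrib_right mult_ac)
  moreover have "cinner w (a *s v) = a * cnj (cinner v w)" for a
    by (simp add: cinner_def sum_distrib_left mult_ac)
  ultimately show ?thesis
    by (simp add: complex_norm_square del: of_real_power)
qed

text \<open>The left side depends only on the operator, the right side is a sum of squares. Hence a
  vector orthogonal to all members of one decomposition is orthogonal to those of any other.\<close>

lemma cinner_sum_ket_bra:
  assumes "finite L"
  shows "cinner w ((\<Sum>l\<in>L. ket_bra (\<psi> l)) *v w) = of_real (\<Sum>l\<in>L. (cmod (cinner (\<psi> l) w))\<^sup>2)"
  using assms
  by (induction rule: finite_induct)
    (simp_all add: matrix_vector_mult_add_rdistrib cinner_add_right cinner_ket_bra cinner_zero_right del: of_real_power)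

lemma inner_eq_Re_cinner: "v \<bullet> w = Re (cinner v w)"
  by (simp add: inner_vec_def cinner_def inner_complex_def)

text \<open>Let \<open>z\<close> be the component of \<open>\<psi> l\<close> orthogonal to the span.
  The quadratic form vanishes at \<open>z\<close> by the decomposition into the
  \<open>\<phi> k\<close>, so \<open>\<psi> l\<close> is orthogonal to \<open>z\<close>, which
  forces \<open>z = 0\<close>.\<close>

lemma decomposition_in_span:
  fixes \<phi> \<psi> :: "nat \<Rightarrow> complex^'n"
  assumes "finite K" "finite L" "(\<Sum>l\<in>L. ket_bra (\<psi> l)) = (\<Sum>k\<in>K. ket_bra (\<phi> k))" "l \<in> L"
  shows "\<psi> l \<in> vec.span (\<phi> ` K)"
proof -
  let ?S = "vec.span (\<phi> ` K)"
  have scaleR: "r *\<^sub>R v = of_real r *s v" for r and v :: "complex^'n"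
    by (simp add: vec_eq_iff scaleR_conv_of_real[where 'a = complex])
  \<comment> \<open>The orthogonal splitting below is one of real inner product spaces, so the
    complex span is regarded as a real subspace.\<close>
  have "subspace ?S"
    by (auto simp: subspace_def scaleR intro: vec.span_zero vec.span_add vec.span_scale)
  then have span: "span ?S = ?S"
    by simp
  obtain y z where yz: "y \<in> span ?S" "\<And>w. w \<in> span ?S \<Longrightarrow> orthogonal z w" "\<psi> l = y + z"
    using orthogonal_subspace_decomp_exists[of ?S "\<psi> l"] by metis
  \<comment> \<open>Real orthogonality to \<open>w\<close> gives only the real part of
    \<open>cinner w z\<close>; orthogonality to \<open>\<i> *s w\<close> gives the imaginary
    part.\<close>
  have orth: "cinner w z = 0" if "w \<in> ?S" for w
  proof -
    have "orthogonal z w" "orthogonal z (\<i> *s w)"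
      using yz(2) that vec.span_scale unfolding span by blast+
    then have "Re (cinner w z) = 0" "Re (cinner (\<i> *s w) z) = 0"
      by (simp_all add: orthogonal_def inner_commute flip: inner_eq_Re_cinner)
    moreover have "cinner (\<i> *s w) z = - \<i> * cinner w z"
      by (simp add: cinner_def sum_distrib_left mult_ac)
    ultimately show ?thesis
      by (simp add: complex_eq_iff)
  qed
  have "complex_of_real (\<Sum>l\<in>L. (cmod (cinner (\<psi> l) z))\<^sup>2) = of_real (\<Sum>k\<in>K. (cmod (cinner (\<phi> k) z))\<^sup>2)"
    using cinner_sum_ket_bra assms(1-3) by metis
  then have "(\<Sum>l\<in>L. (cmod (cinner (\<psi> l) z))\<^sup>2) = (\<Sum>k\<in>K. (cmod (cinner (\<phi> k) z))\<^sup>2)"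
    by (simp only: of_real_eq_iff)
  also have "\<dots> = 0"
    by (simp add: orth vec.span_base)
  finally have "cinner (\<psi> l) z = 0"
    using assms(2,4) by (simp add: sum_nonneg_eq_0_iff)
  then have "\<psi> l \<bullet> z = 0"
    by (simp add: inner_eq_Re_cinner)
  moreover have "y \<bullet> z = 0"
    using yz(1,2) by (simp add: orthogonal_def inner_commute)
  ultimately have "z = 0"
    by (simp add: yz(3) inner_add_left)
  then show ?thesis
    using yz(1,3) span by simp
qed

lemma span_image_sum:
  assumes "finite K" "x \<in> vec.span (\<phi> ` K)"
  obtains c where "x = (\<Sum>k\<in>K. c k *s \<phi> k)"
proof -
  have "\<exists>c. x = (\<Sum>k\<in>K. c k *s \<phi> k)"
    using assms(2)
  proof (induction rule: vec.span_induct_alt)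
    case base
    show ?case
      by (intro exI[of _ "\<lambda>_. 0"]) simp
  next
    case (step a y z)
    then obtain k c where k: "k \<in> K" "y = \<phi> k" and c: "z = (\<Sum>k\<in>K. c k *s \<phi> k)"
      by blast
    have "(\<Sum>j\<in>K. (if j = k then a else 0) *s \<phi> j) = a *s \<phi> k"
      using k assms(1) by (simp add: if_distrib[of "\<lambda>t. t *s _"] cong: if_cong)
    then show ?case
      by (intro exI[of _ "\<lambda>j. (if j = k then a else 0) + c j"])
        (simp add: vec.scale_left_distrib sum.distrib k c)
  qed
  then show thesis
    using that by blast
qed

section \<open>Linear independence, and isometries between decompositions\<close>

text \<open>A dimension count: a family of at most \<open>dim V\<close> members whose span contains
  \<open>V\<close> can have neither repetitions nor linear dependences.\<close>

lemma spanning_family_coeff_zero: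
  fixes \<phi> :: "'i \<Rightarrow> 'a::field^'n"
  assumes "finite K" "V \<subseteq> vec.span (\<phi> ` K)" "card K \<le> vec.dim V"
    and "(\<Sum>k\<in>K. c k *s \<phi> k) = 0" "k \<in> K"
  shows "c k = 0"
proof -
  have "vec.dim V \<le> card (\<phi> ` K)"
    using assms by (intro vec.dim_le_card) auto
  moreover have "card (\<phi> ` K) \<le> card K"
    using assms by (intro card_image_le)
  ultimately have card: "card (\<phi> ` K) = card K" "card (\<phi> ` K) \<le> vec.dim V"
    using assms(3) by linarith+
  then have inj: "inj_on \<phi> K"
    using assms(1) eq_card_imp_inj_on by blast
  have "vec.dim V \<le> vec.dim (vec.span (\<phi> ` K))"
    using assms(2) by (rule vec.dim_subset)
  then have "vec.independent (\<phi> ` K)"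
    using card assms(1)
    by (intro vec.card_le_dim_spanning[where V = "vec.span (\<phi> ` K)"]) (auto intro: vec.span_superset[THEN subsetD])
  \<comment> \<open>Independence is a property of the set of vectors, so the coefficients are
    carried from indices to vectors by the inverse of \<open>\<phi>\<close>.\<close>
  moreover have "(\<Sum>v\<in>\<phi> ` K. c (the_inv_into K \<phi> v) *s v) = 0"
    using assms(4) by (simp add: sum.reindex[OF inj] the_inv_into_f_f[OF inj])
  ultimately have "c (the_inv_into K \<phi> (\<phi> k)) = 0"
    using assms(1,5) by (intro vec.independentD[where t = "\<phi> ` K"]) auto
  then show ?thesis
    by (simp add: the_inv_into_f_f[OF inj assms(5)])
qed

text \<open>Row \<open>i\<close> of the operator is the combination of the conjugated vectors with
  coefficients \<open>\<phi> k $ i\<close>. These vectors therefore span the row space, whose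
  dimension is the rank; the relation is conjugated to apply their independence.\<close>

lemma sum_ket_bra_coeff_zero:
  fixes \<phi> :: "nat \<Rightarrow> complex^'n"
  assumes "finite K" "card K \<le> rank (\<Sum>k\<in>K. ket_bra (\<phi> k))"
    and "(\<Sum>k\<in>K. c k *s \<phi> k) = 0" "k \<in> K"
  shows "c k = 0"
proof -
  define \<phi>' where "\<phi>' k = (\<chi> i. cnj (\<phi> k $ i))" for k
  have "rows (\<Sum>k\<in>K. ket_bra (\<phi> k)) \<subseteq> vec.span (\<phi>' ` K)"
  proof
    fix r assume "r \<in> rows (\<Sum>k\<in>K. ket_bra (\<phi> k))"
    then obtain i where "r = row i (\<Sum>k\<in>K. ket_bra (\<phi> k))"
      by (auto simp: rows_def)
    then have "r = (\<Sum>k\<in>K. (\<phi> k $ i) *s \<phi>' k)"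
      by (simp add: vec_eq_iff row_def ket_bra_def \<phi>'_def)
    then show "r \<in> vec.span (\<phi>' ` K)"
      by (simp add: vec.span_sum vec.span_scale vec.span_base)
  qed
  moreover have "(\<Sum>k\<in>K. cnj (c k) *s \<phi>' k) = 0"
  proof -
    have "cnj ((\<Sum>k\<in>K. c k *s \<phi> k) $ i) = 0" for i
      using assms(3) by simp
    then show ?thesis
      by (simp add: vec_eq_iff \<phi>'_def)
  qed
  ultimately have "cnj (c k) = 0"
    using assms by (intro spanning_family_coeff_zero[where K = K and \<phi> = \<phi>' and c = "\<lambda>k. cnj (c k)"])
      (auto simp: row_rank_def_gen)
  then show ?thesis
    by simp
qed

text \<open>The coefficients enter only through the Gram matrix of their columns. The sums are
  nested so that, for fixed \<open>j\<close>, the right side is a linear combination of the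
  \<open>\<phi> k\<close>.\<close>

lemma sum_ket_bra_linear_combination:
  "(\<Sum>l\<in>L. ket_bra (\<Sum>k\<in>K. c l k *s \<phi> k)) $ i $ j =
    (\<Sum>k\<in>K. (\<Sum>k'\<in>K. (\<Sum>l\<in>L. c l k * cnj (c l k')) * cnj (\<phi> k' $ j)) * \<phi> k $ i)"
proof -
  have "(\<Sum>l\<in>L. ket_bra (\<Sum>k\<in>K. c l k *s \<phi> k)) $ i $ j =
    (\<Sum>l\<in>L. \<Sum>k\<in>K. \<Sum>k'\<in>K. c l k * \<phi> k $ i * (cnj (c l k') * cnj (\<phi> k' $ j)))"
    by (simp add: ket_bra_def sum_product)
  also have "\<dots> = (\<Sum>k\<in>K. \<Sum>k'\<in>K. \<Sum>l\<in>L. c l k * \<phi> k $ i * (cnj (c l k') * cnj (\<phi> k' $ j)))"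
    by (subst sum.swap, intro sum.cong refl, rule sum.swap)
  finally show ?thesis
    by (simp add: sum_distrib_left sum_distrib_right mult_ac)
qed

lemma sum_ket_bra_isometry:
  assumes "finite K"
    and "\<And>k k'. k \<in> K \<Longrightarrow> k' \<in> K \<Longrightarrow> (\<Sum>l\<in>L. c l k * cnj (c l k')) = (if k = k' then 1 else 0)"
  shows "(\<Sum>l\<in>L. ket_bra (\<Sum>k\<in>K. c l k *s \<phi> k)) = (\<Sum>k\<in>K. ket_bra (\<phi> k))"
proof -
  have "(\<Sum>k'\<in>K. (\<Sum>l\<in>L. c l k * cnj (c l k')) * cnj (\<phi> k' $ j)) = cnj (\<phi> k $ j)" if "k \<in> K" for k j
  proof -
    have "(\<Sum>k'\<in>K. (\<Sum>l\<in>L. c l k * cnj (c l k')) * cnj (\<phi> k' $ j)) =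
      (\<Sum>k'\<in>K. if k = k' then cnj (\<phi> k' $ j) else 0)"
      using assms(2)[OF that] by (intro sum.cong) auto
    then show ?thesis
      using that assms(1) by simp
  qed
  then show ?thesis
    unfolding vec_eq_iff sum_ket_bra_linear_combination
    by (simp add: ket_bra_def mult.commute)
qed

text \<open>Converse of \<open>sum_ket_bra_isometry\<close>. The difference \<open>M\<close> of the
  Gram matrix and the identity is annihilated by using independence of the \<open>\<phi> k\<close>
  twice: first in the outer index, then, after conjugation, in the inner one.\<close>

lemma isometry_if_sum_ket_bra_eq:
  fixes \<phi> :: "nat \<Rightarrow> complex^'n"
  assumes "finite K" "card K \<le> rank (\<Sum>k\<in>K. ket_bra (\<phi> k))"
    and eq: "(\<Sum>l\<in>L. ket_bra (\<Sum>k\<in>K. c l k *s \<phi> k)) = (\<Sum>k\<in>K. ket_bra (\<phi> k))"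
    and "k \<in> K" "k' \<in> K"
  shows "(\<Sum>l\<in>L. c l k * cnj (c l k')) = (if k = k' then 1 else 0)"
proof -
  define M where "M k k' = (\<Sum>l\<in>L. c l k * cnj (c l k')) - (if k = k' then 1 else 0)" for k k'
  have zero: "a k = 0" if "(\<Sum>k\<in>K. a k *s \<phi> k) = 0" "k \<in> K" for a k
    using sum_ket_bra_coeff_zero[OF assms(1,2) that] .
  have row: "(\<Sum>k'\<in>K. M k k' * cnj (\<phi> k' $ j)) =
    (\<Sum>k'\<in>K. (\<Sum>l\<in>L. c l k * cnj (c l k')) * cnj (\<phi> k' $ j)) - cnj (\<phi> k $ j)" if "k \<in> K" for k j
    using that assms(1)
    by (simp add: M_def left_diff_distrib sum_subtractf if_distrib[of "\<lambda>t. t * _"] cong: if_cong)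
  have "(\<Sum>k\<in>K. (\<Sum>k'\<in>K. M k k' * cnj (\<phi> k' $ j)) *s \<phi> k) = 0" for j
  proof -
    have "(\<Sum>k\<in>K. (\<Sum>k'\<in>K. M k k' * cnj (\<phi> k' $ j)) * \<phi> k $ i) = 0" for i
      using eq by (simp add: row left_diff_distrib sum_subtractf flip: sum_ket_bra_linear_combination)
        (simp add: ket_bra_def mult.commute)
    then show ?thesis
      by (simp add: vec_eq_iff)
  qed
  from zero[OF this assms(4)] have "(\<Sum>k'\<in>K. M k k' * cnj (\<phi> k' $ j)) = 0" for j .
  then have "cnj (\<Sum>k'\<in>K. M k k' * cnj (\<phi> k' $ j)) = 0" for j
    by simp
  then have "(\<Sum>k'\<in>K. cnj (M k k') *s \<phi> k') = 0"
    by (simp add: vec_eq_iff)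
  from zero[OF this assms(5)] have "M k k' = 0"
    by simp
  then show ?thesis
    by (simp add: M_def)
qed

section \<open>Arbitrary finite index sets, and orthogonality of characters\<close>

text \<open>This admits decompositions indexed by a set of functions. The norm bound in
  \<open>decomposition\<close> comes from the trace: the squared norms add up to 1.\<close>

lemma sum_G_conc_in_G_values:
  fixes \<psi> :: "'i \<Rightarrow> complex^('d::finite \<times> 'd)"
  assumes "finite L" "trace (\<Sum>l\<in>L. ket_bra (\<psi> l)) = 1"
  shows "(\<Sum>l\<in>L. G_conc (\<psi> l)) \<in> G_values (\<Sum>l\<in>L. ket_bra (\<psi> l))"
proof -
  obtain h where h: "bij_betw h {1..card L} L"
    using ex_bij_betw_nat_finite_1[OF assms(1)] by blast
  have "complex_of_real (\<Sum>l\<in>L. (norm (\<psi> l))\<^sup>2) = 1"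
    using assms(2) by (simp add: trace_sum trace_ket_bra)
  then have sum: "(\<Sum>l\<in>L. (norm (\<psi> l))\<^sup>2) = 1"
    using of_real_eq_1_iff by blast
  have "norm (\<psi> l) \<le> 1" if "l \<in> L" for l
    using member_le_sum[OF that, of "\<lambda>l. (norm (\<psi> l))\<^sup>2"] assms(1) sum by (simp add: abs_square_le_1)
  then have "decomposition (\<Sum>l\<in>L. ket_bra (\<psi> l)) (card L) (\<psi> \<circ> h)"
    using bij_betwE[OF h] sum.reindex_bij_betw[OF h, of "\<lambda>l. ket_bra (\<psi> l)"]
    by (auto simp: decomposition_def)
  moreover have "(\<Sum>l\<in>L. G_conc (\<psi> l)) = (\<Sum>l=1..card L. G_conc ((\<psi> \<circ> h) l))"
    using sum.reindex_bij_betw[OF h, of "\<lambda>l. G_conc (\<psi> l)"] by simp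
  ultimately show ?thesis
    unfolding G_values_def by blast
qed

text \<open>For distinct \<open>k\<close> and \<open>k'\<close> the sum factors over the
  coordinates, and the factor at \<open>k\<close> is a full geometric sum of powers of
  \<open>\<omega>\<close>, hence zero.\<close>

lemma sum_roots_of_unity_PiE:
  fixes \<omega> :: complex
  assumes "finite K" "\<omega> ^ d = 1" "\<omega> \<noteq> 1" "cmod \<omega> = 1" "k \<in> K" "k' \<in> K"
  shows "(\<Sum>f\<in>Pi\<^sub>E K (\<lambda>_. {..<d}). \<omega> ^ f k * cnj (\<omega> ^ f k')) = (if k = k' then of_nat (d ^ card K) else 0)"
proof (cases "k = k'")
  case True
  then have "\<omega> ^ f k * cnj (\<omega> ^ f k') = 1" for f
    using complex_norm_square[of "\<omega> ^ f k"] assms(4) by (simp add: norm_power)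
  then show ?thesis
    using True assms(1) by (simp add: card_PiE)
next
  case False
  define g where "g j m = (if j = k then \<omega> ^ m else if j = k' then cnj (\<omega> ^ m) else 1)" for j m
  have "\<omega> ^ f k * cnj (\<omega> ^ f k') = (\<Prod>j\<in>K. g j (f j))" for f
    using assms(1,5,6) False
    by (simp add: g_def prod.remove[of K k] prod.remove[of "K - {k}" k'])
  then have "(\<Sum>f\<in>Pi\<^sub>E K (\<lambda>_. {..<d}). \<omega> ^ f k * cnj (\<omega> ^ f k')) = (\<Prod>j\<in>K. \<Sum>m<d. g j m)"
    using assms(1) by (simp add: prod_sum_PiE)
  also have "(\<Sum>m<d. g k m) = 0"
    using assms(2,3) by (simp add: g_def sum_gp_strict)
  then have "(\<Prod>j\<in>K. \<Sum>m<d. g j m) = 0"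
    using assms(1,5) by (auto simp: prod_zero_iff)
  finally show ?thesis
    using False by simp
qed

section \<open>The lower and the upper bound on \<open>G_mixed\<close>\<close>

theorem theorem7:
  fixes \<rho> :: "complex^('d::finite \<times> 'd)^('d \<times> 'd)"
    and \<phi> :: "nat \<Rightarrow> complex^('d \<times> 'd)"
    and lam :: "nat \<Rightarrow> real"
    and n :: nat
  assumes "2 \<le> CARD('d)"
    and "density_operator \<rho>"
    and "rank \<rho> = n"
    and "\<rho> \<in> class_D"
    and "decomposition \<rho> n \<phi>"
    and "diagonal_tensor n (tau \<phi>)"
    and "\<And>k. k \<in> {1..n} \<Longrightarrow> tau \<phi> (\<lambda>_. k) = of_real (lam k)"
    and "\<And>k. k \<in> {1..n} \<Longrightarrow> 0 \<le> lam k"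
    and "\<And>k. k \<in> {1..n} \<Longrightarrow> lam k \<le> lam 1"
    and "lam 1 > (\<Sum>k=2..n. lam k)"
  shows "lam 1 powr (2 / real CARD('d)) - (\<Sum>k=2..n. lam k powr (2 / real CARD('d))) \<le> G_mixed \<rho>
    \<and> G_mixed \<rho> \<le> \<bar>lam 1 - (\<Sum>k=2..n. lam k)\<bar> powr (2 / real CARD('d))"
proof
  let ?d = "real CARD('d)"
  have trace: "trace \<rho> = 1"
    using assms(2) by (simp add: density_operator_def)
  have \<rho>: "\<rho> = (\<Sum>k=1..n. ket_bra (\<phi> k))"
    using assms(5) by (simp add: decomposition_def)
  have n: "1 \<le> n"
  proof (rule ccontr)
    assume "\<not> 1 \<le> n"
    then have "\<rho> = 0"
      using \<rho> by simp
    then show False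
      using trace by (simp add: trace_def)
  qed
  then have "{1..n} = insert 1 {2..n}"
    by auto
  then have split: "sum g {1..n} = g 1 + sum g {2..n}" for g :: "nat \<Rightarrow> complex"
    by simp
  \<comment> \<open>There are as many vectors as the rank, which makes the coefficients of every
    other decomposition unique and their columns orthonormal.\<close>
  have indep: "card {1..n} \<le> rank (\<Sum>k=1..n. ket_bra (\<phi> k))"
    using assms(3) \<rho> by simp
  note G = G_conc_diagonal_tensor[OF assms(6,7)]
  show "lam 1 powr (2 / ?d) - (\<Sum>k=2..n. lam k powr (2 / ?d)) \<le> G_mixed \<rho>"
  proof -
    \<comment> \<open>The minimum is attained, so a single optimal decomposition is to be
      estimated.\<close>
    obtain m \<psi> where \<psi>: "decomposition \<rho> m \<psi>" and Gm: "G_mixed \<rho> = (\<Sum>l=1..m. G_conc (\<psi> l))"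
      using G_mixed_minimum(1)[OF trace assms(5)] by (auto simp: G_values_def)
    have eq: "(\<Sum>l=1..m. ket_bra (\<psi> l)) = (\<Sum>k=1..n. ket_bra (\<phi> k))"
      using \<psi> \<rho> by (simp add: decomposition_def)
    have "\<exists>c. \<psi> l = (\<Sum>k=1..n. c k *s \<phi> k)" if "l \<in> {1..m}" for l
      using span_image_sum[OF _ decomposition_in_span[OF _ _ eq that]] by (metis finite_atLeastAtMost)
    then obtain c where c: "\<And>l. l \<in> {1..m} \<Longrightarrow> \<psi> l = (\<Sum>k=1..n. c l k *s \<phi> k)"
      by metis
    have "(\<Sum>l=1..m. c l k * cnj (c l k)) = 1" if "k \<in> {1..n}" for k
      using isometry_if_sum_ket_bra_eq[OF _ indep, of c "{1..m}" k k] eq c that by simp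
    then have "complex_of_real (\<Sum>l=1..m. (cmod (c l k))\<^sup>2) = 1" if "k \<in> {1..n}" for k
      using that by (simp add: complex_norm_square del: of_real_power)
    then have col: "(\<Sum>l=1..m. (cmod (c l k))\<^sup>2) = 1" if "k \<in> {1..n}" for k
      using that of_real_eq_1_iff by blast
    \<comment> \<open>The bound is proved for each member: the term of index 1 is isolated by the
      triangle inequality, and subadditivity applies because \<open>2 / d\<close> is at most 1 for
      \<open>d \<ge> 2\<close>.\<close>
    have "lam 1 powr (2 / ?d) * (cmod (c l 1))\<^sup>2 - (\<Sum>k=2..n. lam k powr (2 / ?d) * (cmod (c l k))\<^sup>2)
      \<le> G_conc (\<psi> l)" if "l \<in> {1..m}" for l
    proof -
      define S where "S = (\<Sum>k=1..n. of_real (lam k) * c l k ^ CARD('d))"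
      have norm: "cmod (of_real (lam k) * c l k ^ CARD('d)) = lam k * cmod (c l k) ^ CARD('d)"
        if "k \<in> {1..n}" for k
        using assms(8)[OF that] by (simp add: norm_mult norm_power)
      have "S = of_real (lam 1) * c l 1 ^ CARD('d) + (\<Sum>k=2..n. of_real (lam k) * c l k ^ CARD('d))"
        by (simp only: S_def split)
      then have "of_real (lam 1) * c l 1 ^ CARD('d) = S - (\<Sum>k=2..n. of_real (lam k) * c l k ^ CARD('d))"
        by simp
      then have "cmod (of_real (lam 1) * c l 1 ^ CARD('d))
        \<le> cmod S + cmod (\<Sum>k=2..n. of_real (lam k) * c l k ^ CARD('d))"
        using norm_triangle_ineq4 by metis
      also have "cmod (\<Sum>k=2..n. of_real (lam k) * c l k ^ CARD('d))
        \<le> (\<Sum>k=2..n. lam k * cmod (c l k) ^ CARD('d))"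
        using norm by (intro sum_norm_le) simp
      finally have "lam 1 * cmod (c l 1) ^ CARD('d) \<le> cmod S + (\<Sum>k=2..n. lam k * cmod (c l k) ^ CARD('d))"
        using norm[of 1] n by simp
      then have "(lam 1 * cmod (c l 1) ^ CARD('d)) powr (2 / ?d)
        \<le> (cmod S + (\<Sum>k=2..n. lam k * cmod (c l k) ^ CARD('d))) powr (2 / ?d)"
        using assms(8)[of 1] n by (intro powr_mono2) auto
      also have "\<dots> \<le> cmod S powr (2 / ?d) + (\<Sum>k=2..n. lam k * cmod (c l k) ^ CARD('d)) powr (2 / ?d)"
        using assms(1,8) by (intro powr_add_le sum_nonneg) auto
      also have "(\<Sum>k=2..n. lam k * cmod (c l k) ^ CARD('d)) powr (2 / ?d)
        \<le> (\<Sum>k=2..n. (lam k * cmod (c l k) ^ CARD('d)) powr (2 / ?d))"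
        using assms(1,8) by (intro powr_sum_le) auto
      also have "\<dots> = (\<Sum>k=2..n. lam k powr (2 / ?d) * (cmod (c l k))\<^sup>2)"
        using assms(8) by (intro sum.cong refl powr_mult_power) auto
      also have "(lam 1 * cmod (c l 1) ^ CARD('d)) powr (2 / ?d) = lam 1 powr (2 / ?d) * (cmod (c l 1))\<^sup>2"
        using assms(8)[of 1] n by (intro powr_mult_power) auto
      also have "cmod S powr (2 / ?d) = G_conc (\<psi> l)"
        unfolding c[OF that] S_def by (rule G[symmetric])
      finally show ?thesis
        by simp
    qed
    then have "(\<Sum>l=1..m. lam 1 powr (2 / ?d) * (cmod (c l 1))\<^sup>2
        - (\<Sum>k=2..n. lam k powr (2 / ?d) * (cmod (c l k))\<^sup>2)) \<le> G_mixed \<rho>"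
      unfolding Gm by (rule sum_mono)
    \<comment> \<open>After exchanging the sums, the unit column norms remove the
      coefficients.\<close>
    moreover have "(\<Sum>l=1..m. \<Sum>k=2..n. lam k powr (2 / ?d) * (cmod (c l k))\<^sup>2)
      = (\<Sum>k=2..n. lam k powr (2 / ?d))"
      by (subst sum.swap) (simp add: col[simplified] flip: sum_distrib_left)
    ultimately show ?thesis
      using col[of 1] n by (simp add: sum_subtractf flip: sum_distrib_left)
  qed
  show "G_mixed \<rho> \<le> \<bar>lam 1 - (\<Sum>k=2..n. lam k)\<bar> powr (2 / ?d)"
  proof -
    define \<omega> where "\<omega> = cis (2 * pi / ?d)"
    \<comment> \<open>For \<open>k \<noteq> 1\<close> this is a \<open>d\<close>-th root of -1, so
      that \<open>lam k\<close> enters with the sign opposite to that of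
      \<open>lam 1\<close>.\<close>
    define z where "z k = (if k = 1 then 1 else cis (pi / ?d))" for k :: nat
    define F where "F = Pi\<^sub>E {1..n} (\<lambda>_. {..<CARD('d)})"
    \<comment> \<open>Each column has \<open>card F\<close> entries of equal modulus; the
      denominator gives it norm one.\<close>
    define c where "c f k = z k * \<omega> ^ f k / of_real (sqrt (card F))" for f k
    have F: "finite F" "card F = CARD('d) ^ n"
      by (simp_all add: F_def finite_PiE card_PiE)
    have cardF: "0 < card F"
      using F by simp
    have cis_power: "cis (a / ?d) ^ CARD('d) = cis a" for a
      by (simp add: Complex.DeMoivre)
    have \<omega>: "\<omega> ^ CARD('d) = 1" "cmod \<omega> = 1"
      by (simp_all add: \<omega>_def cis_power)
    have "\<omega> \<noteq> 1"
    proof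
      assume "\<omega> = 1"
      then have "cos (2 * pi / ?d) = 1"
        by (simp add: \<omega>_def complex_eq_iff)
      \<comment> \<open>For \<open>d \<ge> 2\<close> the angle lies in \<open>(0, pi]\<close>, where
        the cosine is below 1.\<close>
      moreover have "cos (2 * pi / ?d) < cos 0"
        using assms(1) by (intro cos_monotone_0_pi) (auto simp: field_simps)
      ultimately show False
        by simp
    qed
    have z: "z k * cnj (z k) = 1" for k
      by (simp add: z_def cis_cnj cis_mult)
    have iso: "(\<Sum>f\<in>F. c f k * cnj (c f k')) = (if k = k' then 1 else 0)"
      if "k \<in> {1..n}" "k' \<in> {1..n}" for k k'
    proof -
      have "complex_of_real (sqrt (card F)) * of_real (sqrt (card F)) = of_nat (card F)"
        by (simp flip: of_real_mult)
      then have "c f k * cnj (c f k') = z k * cnj (z k') / of_nat (card F) * (\<omega> ^ f k * cnj (\<omega> ^ f k'))" for f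
        by (simp add: c_def)
      then have "(\<Sum>f\<in>F. c f k * cnj (c f k'))
        = z k * cnj (z k') / of_nat (card F) * (\<Sum>f\<in>F. \<omega> ^ f k * cnj (\<omega> ^ f k'))"
        by (simp only: sum_distrib_left)
      then show ?thesis
        using sum_roots_of_unity_PiE[OF _ \<omega>(1) \<open>\<omega> \<noteq> 1\<close> \<omega>(2) that] cardF F z
        by (simp add: F_def)
    qed
    have sum_F: "(\<Sum>f\<in>F. ket_bra (\<Sum>k=1..n. c f k *s \<phi> k)) = \<rho>"
      unfolding \<rho> using iso by (intro sum_ket_bra_isometry) auto
    \<comment> \<open>Since \<open>\<omega> ^ d = 1\<close>, the powers \<open>c f k ^ d\<close> do
      not depend on \<open>f\<close>. All members thus have the same value, and the
      \<open>card F\<close> equal shares add up to the upper bound.\<close>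
    have "G_conc (\<Sum>k=1..n. c f k *s \<phi> k) = \<bar>lam 1 - (\<Sum>k=2..n. lam k)\<bar> powr (2 / ?d) / card F" for f
    proof -
      let ?s = "complex_of_real (sqrt (card F))"
      have "(\<omega> ^ f k) ^ CARD('d) = 1" for k
        using \<omega>(1) by (metis power_commutes power_mult mult.commute power_one)
      moreover have "z k ^ CARD('d) = (if k = 1 then 1 else - 1)" for k
        by (simp add: z_def cis_power)
      ultimately have pow: "c f k ^ CARD('d) = (if k = 1 then 1 else - 1) / ?s ^ CARD('d)" for k
        by (simp add: c_def power_mult_distrib power_divide)
      have "(\<Sum>k=1..n. of_real (lam k) * c f k ^ CARD('d))
        = of_real (lam 1) / ?s ^ CARD('d) + (\<Sum>k=2..n. - of_real (lam k) / ?s ^ CARD('d))"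
        unfolding split by (simp add: pow)
      also have "\<dots> = of_real ((lam 1 - (\<Sum>k=2..n. lam k)) * (1 / sqrt (card F)) ^ CARD('d))"
        by (simp add: sum_negf diff_divide_distrib power_divide flip: sum_divide_distrib)
      finally have "cmod (\<Sum>k=1..n. of_real (lam k) * c f k ^ CARD('d))
        = \<bar>lam 1 - (\<Sum>k=2..n. lam k)\<bar> * (1 / sqrt (card F)) ^ CARD('d)"
        by (simp add: abs_mult del: of_real_mult of_real_diff of_real_power of_real_divide of_real_sum)
      then have "G_conc (\<Sum>k=1..n. c f k *s \<phi> k)
        = \<bar>lam 1 - (\<Sum>k=2..n. lam k)\<bar> powr (2 / ?d) * (1 / sqrt (card F))\<^sup>2"
        by (simp only: G, intro powr_mult_power) auto
      then show ?thesis
        by (simp add: power_divide)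
    qed
    then have "(\<Sum>f\<in>F. G_conc (\<Sum>k=1..n. c f k *s \<phi> k)) = \<bar>lam 1 - (\<Sum>k=2..n. lam k)\<bar> powr (2 / ?d)"
      using cardF by simp
    then have "\<bar>lam 1 - (\<Sum>k=2..n. lam k)\<bar> powr (2 / ?d) \<in> G_values \<rho>"
      using sum_G_conc_in_G_values[OF F(1), of "\<lambda>f. \<Sum>k=1..n. c f k *s \<phi> k"] sum_F trace by simp
    then show ?thesis
      by (rule G_mixed_minimum(2)[OF trace assms(5)])
  qed
qed

end
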